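(* For every integer $k\ge 3$, the graph $E(2.O_k)$ is vertex transitive.
   Context: For $k\ge 3$, let $\Omega=\{1,\dots,2k-1\}$. The extended graph $E(2.O_k)$ is the simple graph with vertex set $\{(v,i) : v\subset\Omega,\ |v|=k-1,\ i\in\{0,1\}\}$ in which $(v,i)$ and $(w,j)$ are adjacent if and only if $i\ne j$ and either $v\cap w=\emptyset$ or $v=w$. A graph is vertex transitive if its automorphism group acts transitively on its vertex set. *)

theory Defs
  imports "Graph_Theory.Pair_Digraph" "Graph_Theory.Digraph_Isomorphism" "HOL-Algebra.Group_Action"
begin

text \<open>Simple graphs are the locale \<^term>\<open>pair_graph\<close>: an edge is a pair of opposite
  arcs, and there are no loops.\<close>

definition graph_auto :: "'a pair_pre_digraph \<Rightarrow> ('a \<Rightarrow> 'a) set" where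
  "graph_auto G = {f \<in> Bij (pverts G).
     \<forall>u \<in> pverts G. \<forall>v \<in> pverts G. (u, v) \<in> parcs G \<longleftrightarrow> (f u, f v) \<in> parcs G}"

definition graph_AutoGroup :: "'a pair_pre_digraph \<Rightarrow> ('a \<Rightarrow> 'a) monoid" where
  "graph_AutoGroup G = BijGroup (pverts G) \<lparr>carrier := graph_auto G\<rparr>"

definition vertex_transitive :: "'a pair_pre_digraph \<Rightarrow> bool" where
  "vertex_transitive G \<longleftrightarrow> transitive_action (graph_AutoGroup G) (pverts G) (\<lambda>f. f)"

definition ext_2O_verts :: "nat \<Rightarrow> (nat set \<times> nat) set" where
  "ext_2O_verts k = {(v, i). v \<subseteq> {1..2 * k - 1} \<and> card v = k - 1 \<and> i \<in> {0, 1}}"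

definition ext_2O :: "nat \<Rightarrow> (nat set \<times> nat) pair_pre_digraph" where
  "ext_2O k = \<lparr>pverts = ext_2O_verts k,
     parcs = {((v, i), (w, j)) | v i w j.
       (v, i) \<in> ext_2O_verts k \<and> (w, j) \<in> ext_2O_verts k \<and>
       i \<noteq> j \<and> (v \<inter> w = {} \<or> v = w)}\<rparr>"

lemma pair_graph_ext_2O: "pair_graph (ext_2O k)"
proof -
  have "ext_2O_verts k \<subseteq> Pow {1..2 * k - 1} \<times> {0, 1}"
    by (auto simp: ext_2O_verts_def)
  then have fin: "finite (ext_2O_verts k)"
    by (rule finite_subset) simp
  have "parcs (ext_2O k) \<subseteq> ext_2O_verts k \<times> ext_2O_verts k"
    by (auto simp: ext_2O_def)
  then have fin_arcs: "finite (parcs (ext_2O k))"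
    by (rule finite_subset) (simp add: fin)
  show ?thesis
    by unfold_locales
      (use fin fin_arcs in \<open>auto simp: ext_2O_def symmetric_def intro!: symI\<close>)
qed

lemma subgroup_graph_auto: "subgroup (graph_auto G) (BijGroup (pverts G))"
proof
  show "graph_auto G \<subseteq> carrier (BijGroup (pverts G))"
    by (auto simp: graph_auto_def BijGroup_def)
next
  fix f g assume fg: "f \<in> graph_auto G" "g \<in> graph_auto G"
  then have "f \<in> Bij (pverts G)" "g \<in> Bij (pverts G)" "\<And>x. x \<in> pverts G \<Longrightarrow> g x \<in> pverts G"
    using Bij_imp_funcset by (fastforce simp: graph_auto_def)+
  then show "f \<otimes>\<^bsub>BijGroup (pverts G)\<^esub> g \<in> graph_auto G"
    using fg by (auto simp: graph_auto_def BijGroup_def compose_Bij compose_eq)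
next
  show "\<one>\<^bsub>BijGroup (pverts G)\<^esub> \<in> graph_auto G"
    by (auto simp: graph_auto_def BijGroup_def id_Bij)
next
  fix f assume f: "f \<in> graph_auto G"
  then have B: "f \<in> Bij (pverts G)" by (simp add: graph_auto_def)
  have mem: "inv_into (pverts G) f x \<in> pverts G" if "x \<in> pverts G" for x
    using B that by (rule Bij_inv_into_mem)
  have inv: "f (inv_into (pverts G) f x) = x" if "x \<in> pverts G" for x
    using B that by (metis Bij_def Int_iff bij_betw_def f_inv_into_f mem_Collect_eq)
  have "(u, v) \<in> parcs G \<longleftrightarrow> (inv_into (pverts G) f u, inv_into (pverts G) f v) \<in> parcs G"
    if "u \<in> pverts G" "v \<in> pverts G" for u v
    using f mem[OF that(1)] mem[OF that(2)] inv[OF that(1)] inv[OF that(2)]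
    unfolding graph_auto_def by fastforce
  then show "inv\<^bsub>BijGroup (pverts G)\<^esub> f \<in> graph_auto G"
    using B by (simp add: inv_BijGroup graph_auto_def restrict_inv_into_Bij)
qed

lemma vertex_transitive_iff:
  "vertex_transitive G \<longleftrightarrow>
    (\<forall>x \<in> pverts G. \<forall>y \<in> pverts G. \<exists>f \<in> graph_auto G. f x = y)"
proof -
  interpret B: group "BijGroup (pverts G)" by (rule group_BijGroup)
  have "group (graph_AutoGroup G)"
    unfolding graph_AutoGroup_def
    by (rule B.subgroup_imp_group[OF subgroup_graph_auto])
  then have "group_hom (graph_AutoGroup G) (BijGroup (pverts G)) (\<lambda>f. f)"
    using subgroup.subset[OF subgroup_graph_auto, of G]
    by (auto simp: group_hom_def group_hom_axioms_def graph_AutoGroup_def hom_def B.is_group)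
  then show ?thesis
    by (auto simp: vertex_transitive_def transitive_action_def group_action_def
        transitive_action_axioms_def graph_AutoGroup_def)
qed

text \<open>The automorphisms are the vertex maps of isomorphisms from the graph onto itself.\<close>

lemma graph_auto_iff_isomorphism:
  assumes "pair_graph G"
  shows "f \<in> graph_auto G \<longleftrightarrow> f \<in> extensional (pverts G) \<and>
    (\<exists>h. pre_digraph.digraph_isomorphism (with_proj G) h \<and> iso_verts h = f
      \<and> app_iso h (with_proj G) = with_proj G)"
proof -
  interpret pair_graph G by fact
  have wf: "wf_digraph (with_proj G)" by unfold_locales
  show ?thesis
  proof (intro iffI conjI; (elim conjE exE)?)
    assume f: "f \<in> graph_auto G"
    then show "f \<in> extensional (pverts G)" by (simp add: graph_auto_def Bij_def)
    have inj: "inj_on f (pverts G)" and im: "f ` pverts G = pverts G"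
      and arc: "\<And>u v. u \<in> pverts G \<Longrightarrow> v \<in> pverts G \<Longrightarrow> (u, v) \<in> parcs G \<longleftrightarrow> (f u, f v) \<in> parcs G"
      using f by (auto simp: graph_auto_def Bij_def bij_betw_def)
    let ?h = "\<lparr>iso_verts = f, iso_arcs = map_prod f f, iso_head = snd, iso_tail = fst\<rparr>"
    have inj2: "inj_on (map_prod f f) (parcs G)"
      by (rule inj_on_subset[OF map_prod_inj_on[OF inj inj]])
        (auto dest: in_arcsD1 in_arcsD2)
    have im2: "map_prod f f ` parcs G = parcs G"
    proof (intro equalityI subsetI)
      fix e assume "e \<in> map_prod f f ` parcs G"
      then obtain u v where "(u, v) \<in> parcs G" "e = (f u, f v)" by auto
      then show "e \<in> parcs G" using arc[of u v] in_arcsD1[of u v] in_arcsD2[of u v] by simp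
    next
      fix e assume e: "e \<in> parcs G"
      obtain u v where uv: "e = (u, v)" by (cases e)
      have "u \<in> f ` pverts G" "v \<in> f ` pverts G"
        using e uv im by (auto dest: in_arcsD1 in_arcsD2)
      then obtain u' v' where *: "u' \<in> pverts G" "v' \<in> pverts G" "u = f u'" "v = f v'"
        by blast
      then have "(u', v') \<in> parcs G" using arc[of u' v'] e uv by simp
      then show "e \<in> map_prod f f ` parcs G" using uv * by (intro image_eqI[of _ _ "(u', v')"]) auto
    qed
    have "pre_digraph.digraph_isomorphism (with_proj G) ?h"
      unfolding pre_digraph.digraph_isomorphism_def using wf inj inj2 by auto
    moreover have "app_iso ?h (with_proj G) = with_proj G"
      using im im2 by (simp add: app_iso_def with_proj_def)
    ultimately show "\<exists>h. pre_digraph.digraph_isomorphism (with_proj G) h \<and> iso_verts h = f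
      \<and> app_iso h (with_proj G) = with_proj G"
      by (intro exI[of _ ?h]) simp
  next
    fix h
    assume ext: "f \<in> extensional (pverts G)" and h: "pre_digraph.digraph_isomorphism (with_proj G) h"
      and f: "iso_verts h = f" and app: "app_iso h (with_proj G) = with_proj G"
    have im: "f ` pverts G = pverts G" and im2: "iso_arcs h ` parcs G = parcs G"
      and tl: "iso_tail h = fst" and hd: "iso_head h = snd"
      using app f by (simp_all add: app_iso_def with_proj_def)
    have inj: "inj_on f (pverts G)"
      and ends: "\<And>a. a \<in> parcs G \<Longrightarrow> f (fst a) = fst (iso_arcs h a) \<and> f (snd a) = snd (iso_arcs h a)"
      using h f tl hd by (auto simp: pre_digraph.digraph_isomorphism_def)
    have "(u, v) \<in> parcs G \<longleftrightarrow> (f u, f v) \<in> parcs G" if "u \<in> pverts G" "v \<in> pverts G" for u v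
    proof
      assume "(u, v) \<in> parcs G"
      then show "(f u, f v) \<in> parcs G"
        using ends[of "(u, v)"] im2 by (metis fst_conv imageI prod.collapse snd_conv)
    next
      assume "(f u, f v) \<in> parcs G"
      then obtain a where a: "a \<in> parcs G" "iso_arcs h a = (f u, f v)"
        using im2 by (metis imageE)
      then have "f (fst a) = f u" "f (snd a) = f v" using ends by auto
      moreover have "fst a \<in> pverts G" "snd a \<in> pverts G"
        using a(1) by (auto dest: arc_fst_in_verts arc_snd_in_verts)
      ultimately have "fst a = u" "snd a = v" using inj that by (auto dest: inj_onD)
      then show "(u, v) \<in> parcs G" using a(1) by (metis prod.collapse)
    qed
    then show "f \<in> graph_auto G"
      using ext im inj by (simp add: graph_auto_def Bij_def bij_betw_def)
  qed
qed

end

theory Submission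
  imports Defs
begin

text \<open>
  The symmetric group on \<open>{1..2k-1}\<close> acts on the vertices through the first component and
  the symmetric group on \<open>{0, 1}\<close> through the second. Both actions preserve adjacency, which
  only asks whether the sets are disjoint, whether they are equal, and whether the indices
  differ; these relations are invariant under injections. The product action is transitive: any
  two subsets of equal size of a finite set are related by a permutation of that set. This
  applies to the sets \<open>v\<close> and \<open>w\<close> inside \<open>{1..2k-1}\<close> and also
  to the singletons \<open>{i}\<close> and \<open>{j}\<close> inside \<open>{0, 1}\<close>.
\<close>

text \<open>Complements of equinumerous subsets are equinumerous too, so a bijection between the
  subsets and one between their complements can be glued together.\<close>

lemma ex_bij_betw_mapping_subset:
  assumes "finite S" "A \<subseteq> S" "B \<subseteq> S" "card A = card B"
  shows "\<exists>p. bij_betw p S S \<and> p ` A = B"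
proof -
  have fin: "finite A" "finite B"
    using assms finite_subset by auto
  obtain f where f: "bij_betw f A B"
    using fin assms(4) finite_same_card_bij by blast
  have "card (S - A) = card (S - B)"
    using assms fin by (simp add: card_Diff_subset)
  then obtain g where g: "bij_betw g (S - A) (S - B)"
    using assms(1) finite_same_card_bij by blast
  let ?p = "\<lambda>x. if x \<in> A then f x else g x"
  have "bij_betw ?p (A \<union> (S - A)) (B \<union> (S - B))"
    using f g by (intro bij_betw_disjoint_Un) auto
  then have "bij_betw ?p S S"
    using assms(2,3) by (simp add: Un_absorb1)
  moreover have "?p ` A = B"
    using f by (simp add: bij_betw_def)
  ultimately show ?thesis by blast
qed

lemma map_prod_in_graph_auto_ext_2O:
  assumes p: "bij_betw p {1..2 * k - 1} {1..2 * k - 1}"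
    and t: "bij_betw t {0, 1} {0, 1}"
  shows "restrict (map_prod (image p) t) (ext_2O_verts k) \<in> graph_auto (ext_2O k)"
proof -
  let ?V = "ext_2O_verts k"
  let ?F = "map_prod (image p) t"
  have injp: "inj_on p {1..2 * k - 1}" and injt: "inj_on t {0, 1}"
    using p t by (auto simp: bij_betw_def)
  have "finite ?V"
    by (rule finite_subset[of _ "Pow {1..2 * k - 1} \<times> {0, 1}"])
      (auto simp: ext_2O_verts_def)
  moreover have maps: "?F x \<in> ?V" if "x \<in> ?V" for x
  proof -
    obtain v i where x: "x = (v, i)" by (cases x)
    then have v: "v \<subseteq> {1..2 * k - 1}" "card v = k - 1" and i: "i \<in> {0, 1}"
      using that by (auto simp: ext_2O_verts_def)
    have "p ` v \<subseteq> {1..2 * k - 1}"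
      using p v(1) by (metis bij_betw_imp_surj_on image_mono)
    moreover have "card (p ` v) = k - 1"
      using injp v by (metis card_image inj_on_subset)
    moreover have "t i \<in> {0, 1}"
      using t i by (rule bij_betwE[THEN bspec])
    ultimately show ?thesis
      by (simp add: x ext_2O_verts_def)
  qed
  moreover have "inj_on ?F ?V"
  proof -
    have "inj_on ?F (Pow {1..2 * k - 1} \<times> {0, 1})"
      by (rule map_prod_inj_on[OF inj_on_image_Pow[OF injp] injt])
    then show ?thesis
      by (rule inj_on_subset) (auto simp: ext_2O_verts_def)
  qed
  ultimately have "bij_betw ?F ?V ?V"
    by (simp add: bij_betw_def endo_inj_surj image_subset_iff)
  then have "restrict ?F ?V \<in> Bij ?V"
    by (simp add: Bij_def bij_betw_def)
  moreover have "(x, y) \<in> parcs (ext_2O k) \<longleftrightarrow> (?F x, ?F y) \<in> parcs (ext_2O k)"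
    if V: "x \<in> ?V" "y \<in> ?V" for x y
  proof -
    obtain v i w j where xy: "x = (v, i)" "y = (w, j)"
      by (cases x, cases y)
    have vw: "v \<subseteq> {1..2 * k - 1}" "w \<subseteq> {1..2 * k - 1}"
      and ij: "i \<in> {0, 1}" "j \<in> {0, 1}"
      using V by (auto simp: xy ext_2O_verts_def)
    have "p ` v \<inter> p ` w = p ` (v \<inter> w)"
      using injp vw by (simp add: inj_on_image_Int)
    then have "p ` v \<inter> p ` w = {} \<longleftrightarrow> v \<inter> w = {}" by simp
    moreover have "p ` v = p ` w \<longleftrightarrow> v = w"
      using injp vw by (simp add: inj_on_image_eq_iff)
    moreover have "t i = t j \<longleftrightarrow> i = j"
      using injt ij by (rule inj_on_eq_iff)
    ultimately show ?thesis
      using V maps[OF V(1)] maps[OF V(2)] by (simp add: xy ext_2O_def)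
  qed
  moreover have "pverts (ext_2O k) = ?V"
    by (simp add: ext_2O_def)
  ultimately show ?thesis
    by (simp add: graph_auto_def)
qed

theorem proposition3p1:
  fixes k :: nat
  assumes "k \<ge> 3"
  shows "vertex_transitive (ext_2O k)"
  unfolding vertex_transitive_iff
proof (intro ballI)
  fix x y assume "x \<in> pverts (ext_2O k)" "y \<in> pverts (ext_2O k)"
  then have V: "x \<in> ext_2O_verts k" "y \<in> ext_2O_verts k"
    by (simp_all add: ext_2O_def)
  obtain v i w j where xy: "x = (v, i)" "y = (w, j)"
    by (cases x, cases y)
  have vw: "v \<subseteq> {1..2 * k - 1}" "w \<subseteq> {1..2 * k - 1}" "card v = card w"
    and ij: "{i} \<subseteq> {0, 1}" "{j} \<subseteq> {0, 1}"
    using V by (auto simp: xy ext_2O_verts_def)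
  obtain p where p: "bij_betw p {1..2 * k - 1} {1..2 * k - 1}" "p ` v = w"
    using ex_bij_betw_mapping_subset[OF _ vw] by auto
  obtain t where t: "bij_betw t {0, 1} {0, 1}" "t ` {i} = {j}"
    using ex_bij_betw_mapping_subset[OF _ ij] by auto
  have "restrict (map_prod (image p) t) (ext_2O_verts k) x = y"
    using V p(2) t(2) by (simp add: xy)
  then show "\<exists>f \<in> graph_auto (ext_2O k). f x = y"
    using map_prod_in_graph_auto_ext_2O[OF p(1) t(1)] by blast
qed

end
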